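(* For integers $N\ge1$ and $0\le k\le N$, let $a_k(N)=\int_{g\in S_N}[g_{11}][g_{22}]\cdots[g_{kk}]\,dg$. Then $$a_k(N)=\sum_{l=0}^{k}\binom{k}{l}\frac{1}{(N)_l}\,(-N)^{-(k-l)}.$$ In particular, $a_k(N)>0$ for all $k\ge2$, and $a_0(N)=1$, $a_1(N)=0$. Moreover, if $N\gg k^3$ and $k\ge1$, then $a_k(N)=\tilde a_k(N)\,(1+O(k^3/N))$; that is, there exist absolute constants $C_1,C_2>0$ such that for all integers $k\ge1$ and $N>C_1k^3$ (with $N\ge k$), $$|a_k(N)-\tilde a_k(N)|\le C_2\,\frac{k^3}{N}\,\tilde a_k(N),$$ where $$\tilde a_k(N)=\begin{cases}(2k'-1)!!\,N^{-3k'} & \text{if } k=2k',\\[2pt] \frac{4k'}{3}\,(2k'+1)!!\,N^{-3k'-2} & \text{if } k=2k'+1.\end{cases}$$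
   Context: An element $g$ of the symmetric group $S_N$ is identified with its $N\times N$ permutation matrix: $g_{rs}=1$ if $g(r)=s$ and $g_{rs}=0$ otherwise. $\int_{g\in S_N} f(g)\,dg=\frac{1}{N!}\sum_{g\in S_N}f(g)$. The centered entries are $[g_{ij}]=g_{ij}-\frac1N$; the empty product ($k=0$) is $1$. $(x)_n=x(x-1)\cdots(x-n+1)$ with $(x)_0=1$. For a positive odd integer $n$, $n!!=\prod_{m=1}^{(n+1)/2}(2m-1)$, and $(-1)!!=1$. *)

theory Defs
  imports Complex_Main "HOL-Combinatorics.Permutations"
begin

definition perm_entry :: "(nat \<Rightarrow> nat) \<Rightarrow> nat \<Rightarrow> nat \<Rightarrow> real" where
  "perm_entry g r s = (if g r = s then 1 else 0)"

definition centered_entry :: "nat \<Rightarrow> (nat \<Rightarrow> nat) \<Rightarrow> nat \<Rightarrow> nat \<Rightarrow> real" where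
  "centered_entry N g i j = perm_entry g i j - 1 / real N"

text \<open>The symmetric group on N letters is the set of permutations of \<^term>\<open>{1..N}\<close>,
  extended by the identity outside this set.\<close>

definition perm_integral :: "nat \<Rightarrow> ((nat \<Rightarrow> nat) \<Rightarrow> real) \<Rightarrow> real" where
  "perm_integral N f = (1 / fact N) * (\<Sum>g\<in>{g. g permutes {1..N}}. f g)"

definition a_int :: "nat \<Rightarrow> nat \<Rightarrow> real" where
  "a_int k N = perm_integral N (\<lambda>g. \<Prod>i=1..k. centered_entry N g i i)"

definition falling_fact :: "real \<Rightarrow> nat \<Rightarrow> real" where
  "falling_fact x n = (\<Prod>i<n. x - real i)"

text \<open>Used only for odd \<open>n \<ge> -1\<close>; the argument is an integer so that
  \<open>(-1)!! = 1\<close> is the empty product.\<close>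

definition odd_double_fact :: "int \<Rightarrow> int" where
  "odd_double_fact n = (\<Prod>m=1..(n + 1) div 2. 2 * m - 1)"

definition a_tilde :: "nat \<Rightarrow> nat \<Rightarrow> real" where
  "a_tilde k N =
     (let k' = int (k div 2) in
      if even k then of_int (odd_double_fact (2 * k' - 1)) * real N powi (- 3 * k')
      else 4 * of_int k' / 3 * of_int (odd_double_fact (2 * k' + 1)) * real N powi (- 3 * k' - 2))"

end

theory Submission imports Defs begin

text \<open>Expanding the product of the centered entries over subsets of \<open>{1..k}\<close> and counting
  the permutations that fix a given set of \<open>l\<close> points gives the closed formula: it is a
  binomial transform of the sequence \<open>u\<^sub>l = 1 / (N)\<^sub>l\<close> with weight \<open>- 1 / N\<close>.

  The formula is an alternating sum with heavy cancellation, so neither the sign nor the size of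
  \<open>a\<^sub>k\<close> can be read off from it. What helps is that \<open>u\<close> satisfies the first-order recurrence
  \<open>(N - l) u\<^sub>l\<^sub>+\<^sub>1 = u\<^sub>l\<close>. The binomial transform turns an index shift and a multiplication by
  the index into simple operations, and so this recurrence becomes the three-term recurrence
  \<open>(N - k) a\<^sub>k\<^sub>+\<^sub>1 = k (2 a\<^sub>k / N + a\<^sub>k\<^sub>-\<^sub>1 / N\<^sup>2)\<close> (lemma \<open>a_int_recurrence\<close>). The weight
  \<open>- 1 / N\<close> is exactly what cancels the term in \<open>a\<^sub>k\<close> without a factor \<open>k\<close>. All remaining
  coefficients are positive, and with \<open>a\<^sub>0 = 1\<close> and \<open>a\<^sub>1 = 0\<close> positivity is immediate.

  The asymptotic expression obeys the same recurrence up to small relative errors. Replace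
  \<open>N - k\<close> by \<open>N\<close>. For an odd new index both terms on the right have the same order and
  \<open>a_tilde\<close> satisfies the recurrence exactly; the factor \<open>4 k' / 3\<close> is the solution of the
  resulting inhomogeneous recursion. For an even new index \<open>a_tilde\<close> keeps only the term in
  \<open>a\<^sub>k\<^sub>-\<^sub>1\<close>, and the neglected one is smaller by a factor \<open>O(k\<^sup>2 / N)\<close>. Only positive
  quantities are dropped, so \<open>a_tilde\<close> is a lower bound for \<open>a_int\<close>. Conversely, one step loses a
  factor of at most \<open>1 + 4 k\<^sup>2 / N\<close>, and the accumulated loss \<open>(1 + 4 k\<^sup>2 / N)\<^sup>k\<close> is
  \<open>1 + O(k\<^sup>3 / N)\<close> once \<open>N > 8 k\<^sup>3\<close>.\<close>

section \<open>Permutations with prescribed fixed points\<close>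

lemma sum_Pow_card:
  fixes h :: "nat \<Rightarrow> 'b::semiring_1"
  assumes "finite A"
  shows "(\<Sum>S\<in>Pow A. h (card S)) = (\<Sum>l\<le>card A. of_nat (card A choose l) * h l)"
proof -
  have "(\<Sum>S\<in>Pow A. h (card S)) = (\<Sum>l\<le>card A. \<Sum>S\<in>{S \<in> Pow A. card S = l}. h (card S))"
    using assms by (intro sum.group[symmetric]) (auto intro: card_mono)
  also have "\<dots> = (\<Sum>l\<le>card A. of_nat (card A choose l) * h l)"
    using assms by (intro sum.cong refl) (simp add: n_subsets)
  finally show ?thesis .
qed

lemma permutes_fixing_set_eq:
  "{g. g permutes A \<and> (\<forall>i\<in>S. g i = i)} = {g. g permutes (A - S)}"
proof (intro Collect_cong iffI conjI ballI)
  fix g assume "g permutes A \<and> (\<forall>i\<in>S. g i = i)"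
  then show "g permutes (A - S)" using permutes_superset[of g A "A - S"] by auto
next
  fix g assume g: "g permutes (A - S)"
  then show "g permutes A" by (rule permutes_subset) auto
  show "g i = i" if "i \<in> S" for i using permutes_not_in[OF g] that by auto
qed

lemma falling_fact_Suc: "falling_fact x (Suc l) = falling_fact x l * (x - real l)"
  by (simp add: falling_fact_def)

lemma falling_fact_of_nat:
  "l \<le> N \<Longrightarrow> falling_fact (real N) l * fact (N - l) = fact N"
proof (induction l)
  case 0
  show ?case by (simp add: falling_fact_def)
next
  case (Suc l)
  then have "N - l = Suc (N - Suc l)" by simp
  then have "(fact (N - l) :: real) = real (N - l) * fact (N - Suc l)"
    by (simp only: fact_Suc of_nat_mult)
  with Suc show ?case by (simp add: falling_fact_Suc of_nat_diff algebra_simps)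
qed

text \<open>The product is the indicator of the permutations that fix \<open>S\<close> pointwise, and these are the
  permutations of the complement of \<open>S\<close>.\<close>

lemma perm_integral_fixed_points:
  assumes "S \<subseteq> {1..N}"
  shows "perm_integral N (\<lambda>g. \<Prod>i\<in>S. perm_entry g i i) = 1 / falling_fact (real N) (card S)"
proof -
  have fin: "finite S" using assms finite_subset by blast
  have cardS: "card S \<le> N" using card_mono[OF _ assms] by simp
  have "(\<Prod>i\<in>S. perm_entry g i i) = (if \<forall>i\<in>S. g i = i then 1 else 0)" for g
    using fin by (auto simp: perm_entry_def)
  then have "(\<Sum>g\<in>{g. g permutes {1..N}}. \<Prod>i\<in>S. perm_entry g i i)
      = real (card {g. g permutes {1..N} \<and> (\<forall>i\<in>S. g i = i)})"
    using finite_permutations[of "{1..N}"] by (simp add: sum.If_cases Collect_conj_eq)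
  also have "\<dots> = fact (N - card S)"
    unfolding permutes_fixing_set_eq
    using assms fin card_permutations[of "{1..N} - S" "N - card S"]
    by (simp add: card_Diff_subset)
  finally show ?thesis
    using falling_fact_of_nat[OF cardS]
    by (simp add: perm_integral_def divide_simps) (metis fact_nonzero mult_eq_0_iff mult.commute)
qed

lemma perm_integral_sum: "perm_integral N (\<lambda>g. \<Sum>x\<in>A. c x * f x g)
    = (\<Sum>x\<in>A. c x * perm_integral N (f x))"
  unfolding perm_integral_def
  by (subst sum.swap) (simp add: sum_distrib_left mult_ac)

section \<open>Binomial transforms\<close>

definition binomial_transform :: "'a::comm_ring_1 \<Rightarrow> (nat \<Rightarrow> 'a) \<Rightarrow> nat \<Rightarrow> 'a" where
  "binomial_transform s u k = (\<Sum>l\<le>k. of_nat (k choose l) * u l * s ^ (k - l))"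

text \<open>Pascal's rule, read as a commutation rule between the transform and the index shift. On
  exponential generating functions the transform is multiplication by \<open>exp (s x)\<close> and the shift
  is differentiation, so this is the product rule.\<close>

lemma binomial_transform_shift:
  "binomial_transform s (\<lambda>l. u (Suc l)) k
     = binomial_transform s u (Suc k) - s * binomial_transform s u k"
proof -
  have "s * binomial_transform s u k
      = (\<Sum>l\<le>k. of_nat (k choose l) * u l * s ^ (Suc k - l))"
    unfolding binomial_transform_def sum_distrib_left
    by (intro sum.cong) (auto simp: Suc_diff_le mult_ac)
  also have "\<dots> = (\<Sum>l\<le>Suc k. of_nat (k choose l) * u l * s ^ (Suc k - l))"
    by (simp add: binomial_eq_0)
  also have "\<dots> = u 0 * s ^ Suc k
      + (\<Sum>l\<le>k. of_nat (k choose Suc l) * u (Suc l) * s ^ (k - l))"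
    by (subst sum.atMost_Suc_shift) simp
  finally have "s * binomial_transform s u k + binomial_transform s (\<lambda>l. u (Suc l)) k
      = u 0 * s ^ Suc k
        + (\<Sum>l\<le>k. of_nat (Suc k choose Suc l) * u (Suc l) * s ^ (k - l))"
    by (simp add: binomial_transform_def sum.distrib algebra_simps)
  also have "\<dots> = binomial_transform s u (Suc k)"
    unfolding binomial_transform_def sum.atMost_Suc_shift by simp
  finally show ?thesis by (simp add: algebra_simps)
qed

text \<open>On exponential generating functions, multiplication of the coefficients by their index is
  \<open>x\<close> times the derivative, and the factor \<open>x\<close> can be pulled out of the product with
  \<open>exp (s x)\<close>. On coefficients this is the absorption rule
  \<open>l (k choose l) = k (k - 1 choose l - 1)\<close> summed over \<open>l\<close>.\<close>

lemma binomial_transform_index_mult: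
  "binomial_transform s (\<lambda>l. of_nat l * u l) (Suc k)
     = of_nat (Suc k) * binomial_transform s (\<lambda>l. u (Suc l)) k"
proof -
  have absorb: "(of_nat (Suc k choose Suc l) * of_nat (Suc l) :: 'a)
      = of_nat (Suc k) * of_nat (k choose l)" for l
    using Suc_times_binomial[of l k] by (metis mult.commute of_nat_mult)
  have "binomial_transform s (\<lambda>l. of_nat l * u l) (Suc k)
      = (\<Sum>l\<le>k. (of_nat (Suc k choose Suc l) * of_nat (Suc l)) * u (Suc l) * s ^ (k - l))"
    unfolding binomial_transform_def
    by (subst sum.atMost_Suc_shift) (simp add: mult.assoc)
  also have "\<dots> = of_nat (Suc k) * binomial_transform s (\<lambda>l. u (Suc l)) k"
    unfolding absorb binomial_transform_def sum_distrib_left by (simp add: mult_ac)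
  finally show ?thesis .
qed

section \<open>Closed formula and three-term recurrence\<close>

lemma a_int_eq_binomial_transform:
  assumes "k \<le> N"
  shows "a_int k N
    = binomial_transform (- (1 / real N)) (\<lambda>l. 1 / falling_fact (real N) l) k"
proof -
  let ?s = "- (1 / real N)"
  have "(\<Prod>i=1..k. centered_entry N g i i)
      = (\<Sum>S\<in>Pow {1..k}. ?s ^ (k - card S) * (\<Prod>i\<in>S. perm_entry g i i))" for g
  proof -
    have "(\<Prod>i=1..k. centered_entry N g i i) = (\<Prod>i=1..k. perm_entry g i i + ?s)"
      by (simp add: centered_entry_def)
    also have "\<dots> = (\<Sum>S\<in>Pow {1..k}. ?s ^ (k - card S) * (\<Prod>i\<in>S. perm_entry g i i))"
      unfolding prod_add[OF finite_atLeastAtMost]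
      by (intro sum.cong refl) (auto simp: card_Diff_subset finite_subset mult.commute)
    finally show ?thesis .
  qed
  then have "a_int k N = (\<Sum>S\<in>Pow {1..k}. ?s ^ (k - card S)
      * perm_integral N (\<lambda>g. \<Prod>i\<in>S. perm_entry g i i))"
    by (simp add: a_int_def perm_integral_sum)
  also have "\<dots> = (\<Sum>S\<in>Pow {1..k}. ?s ^ (k - card S) * (1 / falling_fact (real N) (card S)))"
  proof (intro sum.cong refl)
    fix S assume "S \<in> Pow {1..k}"
    then have "S \<subseteq> {1..N}" using assms by fastforce
    then show "?s ^ (k - card S) * perm_integral N (\<lambda>g. \<Prod>i\<in>S. perm_entry g i i)
        = ?s ^ (k - card S) * (1 / falling_fact (real N) (card S))"
      by (simp only: perm_integral_fixed_points)
  qed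
  also have "\<dots> = (\<Sum>l\<le>k. real (k choose l) * (?s ^ (k - l) * (1 / falling_fact (real N) l)))"
    by (subst sum_Pow_card[where h = "\<lambda>l. ?s ^ (k - l) * (1 / falling_fact (real N) l)"]) simp_all
  also have "\<dots> = binomial_transform ?s (\<lambda>l. 1 / falling_fact (real N) l) k"
    unfolding binomial_transform_def by (intro sum.cong refl) (simp only: mult_ac)
  finally show ?thesis .
qed

lemma a_int_0 [simp]: "a_int 0 N = 1"
  by (simp add: a_int_eq_binomial_transform binomial_transform_def falling_fact_def)

lemma a_int_1 [simp]: "N \<ge> 1 \<Longrightarrow> a_int (Suc 0) N = 0"
  by (simp add: a_int_eq_binomial_transform binomial_transform_def falling_fact_def)

text \<open>The transform of \<open>u\<^sub>l = N u\<^sub>l\<^sub>+\<^sub>1 - l u\<^sub>l\<^sub>+\<^sub>1\<close>, evaluated at \<open>k + 1\<close>.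
  The shift rule contributes \<open>- N s a\<^sub>k\<^sub>+\<^sub>1 = a\<^sub>k\<^sub>+\<^sub>1\<close>, which cancels the transform of the
  left-hand side. The bound \<open>k + 2 \<le> N\<close> ensures \<open>l < N\<close> for every \<open>l \<le> k + 1\<close>;
  at \<open>l = N\<close> the recurrence of \<open>u\<close> breaks down, as the next falling factorial vanishes.\<close>

lemma a_int_recurrence:
  assumes "Suc (Suc k) \<le> N"
  shows "(real N - real (Suc k)) * a_int (Suc (Suc k)) N
    = real (Suc k) * (2 / real N * a_int (Suc k) N + 1 / (real N)\<^sup>2 * a_int k N)"
proof -
  define s where "s = - (1 / real N)"
  define u where "u = (\<lambda>l. 1 / falling_fact (real N) l)"
  define b where "b = binomial_transform s u"
  have a: "a_int j N = b j" if "j \<le> N" for j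
    using a_int_eq_binomial_transform[OF that] by (simp add: b_def s_def u_def)
  have shift: "binomial_transform s (\<lambda>l. u (Suc l)) j = b (Suc j) - s * b j" for j
    by (simp add: b_def binomial_transform_shift)
  have shift2: "binomial_transform s (\<lambda>l. u (Suc (Suc l))) k
      = b (Suc (Suc k)) - 2 * s * b (Suc k) + s\<^sup>2 * b k"
    using binomial_transform_shift[of s "\<lambda>l. u (Suc l)" k]
    by (simp add: shift power2_eq_square algebra_simps)
  have u_rec: "u l = real N * u (Suc l) - real l * u (Suc l)" if "l < N" for l
  proof -
    have "u (Suc l) * (real N - real l) = u l"
      using that by (simp add: u_def falling_fact_Suc)
    then show ?thesis by (simp add: algebra_simps)
  qed
  have "b (Suc k) = (\<Sum>l\<le>Suc k. real (Suc k choose l)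
      * (real N * u (Suc l) - real l * u (Suc l)) * s ^ (Suc k - l))"
    unfolding b_def binomial_transform_def using assms
    by (intro sum.cong refl) (metis u_rec atMost_iff le_less_trans less_eq_Suc_le of_nat_id)
  also have "\<dots> = real N * binomial_transform s (\<lambda>l. u (Suc l)) (Suc k)
      - binomial_transform s (\<lambda>l. real l * u (Suc l)) (Suc k)"
    unfolding binomial_transform_def sum_distrib_left sum_subtractf[symmetric]
    by (intro sum.cong refl) (simp add: algebra_simps)
  also have "\<dots> = real N * (b (Suc (Suc k)) - s * b (Suc k))
      - real (Suc k) * (b (Suc (Suc k)) - 2 * s * b (Suc k) + s\<^sup>2 * b k)"
    using binomial_transform_index_mult[of s "\<lambda>l. u (Suc l)" k]
    by (simp only: shift shift2 of_nat_id)
  finally have "b (Suc k) = real N * b (Suc (Suc k)) - real N * s * b (Suc k)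
      - real (Suc k) * (b (Suc (Suc k)) - 2 * s * b (Suc k) + s\<^sup>2 * b k)"
    by (simp add: algebra_simps)
  moreover have "real N * s = -1" using assms by (simp add: s_def)
  ultimately have "(real N - real (Suc k)) * b (Suc (Suc k))
      = real (Suc k) * (- 2 * s * b (Suc k) + s\<^sup>2 * b k)"
    by (simp only:) (simp add: algebra_simps)
  then show ?thesis
    using assms by (simp add: a s_def power_divide)
qed

text \<open>The recurrence has nonnegative coefficients, and among two consecutive indices at most one
  is \<open>1\<close>, the only index where \<open>a_int\<close> vanishes.\<close>

lemma a_int_nonneg: "N \<ge> 1 \<Longrightarrow> k \<le> N \<Longrightarrow> a_int k N \<ge> 0"
  and a_int_pos: "N \<ge> 1 \<Longrightarrow> k \<le> N \<Longrightarrow> k \<noteq> 1 \<Longrightarrow> a_int k N > 0"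
proof -
  have *: "N \<ge> 1 \<Longrightarrow> k \<le> N \<Longrightarrow> a_int k N \<ge> 0 \<and> (k \<noteq> 1 \<longrightarrow> a_int k N > 0)"
  proof (induction k rule: less_induct)
    case (less k)
    consider "k = 0" | "k = 1" | j where "k = Suc (Suc j)"
      by (metis One_nat_def not0_implies_Suc)
    then show ?case
    proof cases
      case 3
      have nonneg: "a_int j N \<ge> 0" "a_int (Suc j) N \<ge> 0"
        and pos: "a_int j N > 0 \<or> a_int (Suc j) N > 0"
        using less 3 less.IH[of j] less.IH[of "Suc j"] by auto
      have "2 / real N * a_int (Suc j) N + 1 / (real N)\<^sup>2 * a_int j N > 0"
        using nonneg pos less.prems
        by (auto intro: add_pos_nonneg add_nonneg_pos)
      then have "(real N - real (Suc j)) * a_int k N > 0"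
        using a_int_recurrence[of j N] less.prems 3 by simp
      then have "a_int k N > 0"
        using less.prems 3 by (simp add: zero_less_mult_iff)
      then show ?thesis by simp
    qed (use less in auto)
  qed
  show "N \<ge> 1 \<Longrightarrow> k \<le> N \<Longrightarrow> a_int k N \<ge> 0"
    and "N \<ge> 1 \<Longrightarrow> k \<le> N \<Longrightarrow> k \<noteq> 1 \<Longrightarrow> a_int k N > 0"
    using * by auto
qed

section \<open>The recurrence satisfied by the asymptotic expression\<close>

lemma odd_double_fact_Suc:
  "odd_double_fact (2 * int m + 1) = (2 * int m + 1) * odd_double_fact (2 * int m - 1)"
proof -
  have "{1..1 + int m} = insert (1 + int m) {1..int m}" by auto
  moreover have "(2 * int m + 2) div 2 = 1 + int m" by simp
  moreover have "1 + int m \<notin> {1..int m}" by simp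
  ultimately show ?thesis by (simp add: odd_double_fact_def)
qed

lemma odd_double_fact_pos: "odd_double_fact n > 0"
  unfolding odd_double_fact_def by (intro prod_pos) auto

lemma a_tilde_even: "a_tilde (2 * m) N
    = of_int (odd_double_fact (2 * int m - 1)) / real N ^ (3 * m)"
proof -
  have half: "2 * m div 2 = m" by simp
  have exponent: "- 3 * int m = - int (3 * m)" by simp
  show ?thesis
    by (simp only: a_tilde_def Let_def half exponent power_int_minus power_int_of_nat)
       (simp add: inverse_eq_divide)
qed

lemma a_tilde_odd: "a_tilde (Suc (2 * m)) N
    = 4 * real m / 3 * of_int (odd_double_fact (2 * int m + 1)) / real N ^ (3 * m + 2)"
proof -
  have half: "Suc (2 * m) div 2 = m" by simp
  have exponent: "- 3 * int m - 2 = - int (3 * m + 2)" by simp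
  show ?thesis
    by (simp only: a_tilde_def Let_def half exponent power_int_minus power_int_of_nat)
       (simp add: inverse_eq_divide)
qed

lemma a_tilde_nonneg: "a_tilde k N \<ge> 0"
proof (cases "even k")
  case True
  then obtain m where "k = 2 * m" by blast
  then show ?thesis using less_imp_le[OF odd_double_fact_pos] by (simp add: a_tilde_even)
next
  case False
  then obtain m where "k = Suc (2 * m)" by (auto elim: oddE)
  then show ?thesis using less_imp_le[OF odd_double_fact_pos] by (simp add: a_tilde_odd)
qed

text \<open>The right-hand side of the recurrence of \<open>a_int\<close>, applied to \<open>a_tilde\<close>, with the leading
  coefficient \<open>N - (k + 1)\<close> replaced by \<open>N\<close>.\<close>

definition a_tilde_step :: "nat \<Rightarrow> nat \<Rightarrow> real" where
  "a_tilde_step k N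
     = real (Suc k) * (2 / (real N)\<^sup>2 * a_tilde (Suc k) N + 1 / real N ^ 3 * a_tilde k N)"

text \<open>With \<open>k = 2 m + 1\<close> and \<open>d = (2 m + 1)!!\<close> both terms are of order \<open>N\<close> to the power
  \<open>- 3 m - 5\<close>, and their coefficients add up as
  \<open>(2 m + 2) (2 + 4 m / 3) d = 4 (m + 1) / 3 (2 m + 3) d\<close>.\<close>

lemma a_tilde_step_odd:
  assumes "odd k" and "N \<ge> 1"
  shows "a_tilde_step k N = a_tilde (Suc (Suc k)) N"
proof -
  obtain m where "k = 2 * m + 1" using assms(1) by (rule oddE)
  then have k: "k = Suc (2 * m)" by simp
  define d where "d = real_of_int (odd_double_fact (2 * int m + 1))"
  have d': "real_of_int (odd_double_fact (2 * int m + 3)) = (2 * real m + 3) * d"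
    using arg_cong[OF odd_double_fact_Suc[of "Suc m"], of real_of_int]
    by (simp add: d_def add.commute)
  define P where "P = real N ^ (3 * m + 2)"
  have P: "real N ^ (3 * m + 3) = P * real N" "real N ^ (3 * m + 5) = P * real N ^ 3"
    by (simp_all add: P_def power_add eval_nat_numeral mult_ac)
  have t0: "a_tilde k N = 4 * real m / 3 * d / P"
    by (simp add: k a_tilde_odd d_def P_def)
  have t1: "a_tilde (Suc k) N = d / (P * real N)"
    using a_tilde_even[of "Suc m" N] P by (simp add: k d_def add.commute)
  have t2: "a_tilde (Suc (Suc k)) N
      = 4 * (real m + 1) / 3 * ((2 * real m + 3) * d) / (P * real N ^ 3)"
    using a_tilde_odd[of "Suc m" N] d' P by (simp add: k add.commute)
  have "P \<noteq> 0" using assms by (simp add: P_def)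
  then show ?thesis
    unfolding a_tilde_step_def t0 t1 t2 using assms(2)
    by (simp add: k divide_simps) (simp add: algebra_simps eval_nat_numeral)
qed

text \<open>Here the term in \<open>a_tilde k\<close> alone reproduces \<open>a_tilde (k + 2)\<close>; the summand of order
  \<open>k\<^sup>2 / N\<close> is the contribution of the odd index \<open>k + 1\<close>.\<close>

lemma a_tilde_step_even:
  assumes "even k" and "N \<ge> 1"
  shows "a_tilde_step k N
    = (1 + 4 * real k * real (Suc k) / (3 * real N)) * a_tilde (Suc (Suc k)) N"
proof -
  obtain m where k: "k = 2 * m" using assms(1) by blast
  define d where "d = real_of_int (odd_double_fact (2 * int m - 1))"
  have d': "real_of_int (odd_double_fact (2 * int m + 1)) = (2 * real m + 1) * d"
    using odd_double_fact_Suc[of m] by (simp add: d_def)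
  define P where "P = real N ^ (3 * m)"
  have P: "real N ^ (3 * m + 2) = P * (real N)\<^sup>2" "real N ^ (3 * m + 3) = P * real N ^ 3"
    by (simp_all add: P_def power_add power2_eq_square)
  have t0: "a_tilde k N = d / P"
    by (simp add: k a_tilde_even d_def P_def)
  have t1: "a_tilde (Suc k) N = 4 * real m / 3 * ((2 * real m + 1) * d) / (P * (real N)\<^sup>2)"
    unfolding k a_tilde_odd d' P ..
  have t2: "a_tilde (Suc (Suc k)) N = (2 * real m + 1) * d / (P * real N ^ 3)"
    using a_tilde_even[of "Suc m" N] d' P by (simp add: k add.commute)
  have "P \<noteq> 0" using assms by (simp add: P_def)
  then show ?thesis
    unfolding a_tilde_step_def t0 t1 t2 using assms(2)
    by (simp add: k divide_simps) (simp add: algebra_simps eval_nat_numeral)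
qed

lemma a_tilde_step_bounds:
  assumes "N \<ge> 1"
  shows "a_tilde (Suc (Suc k)) N \<le> a_tilde_step k N"
    and "a_tilde_step k N
      \<le> (1 + 4 * real k * real (Suc k) / (3 * real N)) * a_tilde (Suc (Suc k)) N"
proof -
  let ?t = "a_tilde (Suc (Suc k)) N" and ?e = "4 * real k * real (Suc k) / (3 * real N)"
  have "?t \<le> (1 + ?e) * ?t"
    using a_tilde_nonneg[of "Suc (Suc k)" N] by (simp add: distrib_right)
  moreover have "a_tilde_step k N = ?t \<or> a_tilde_step k N = (1 + ?e) * ?t"
    using a_tilde_step_odd[OF _ assms] a_tilde_step_even[OF _ assms] by blast
  ultimately show "?t \<le> a_tilde_step k N" and "a_tilde_step k N \<le> (1 + ?e) * ?t"
    by (metis order_refl)+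
qed

section \<open>Two-sided comparison and asymptotics\<close>

text \<open>The form in which \<open>a_tilde_step\<close> can be compared with \<open>a_int\<close>; the prefactor is the price
  of replacing \<open>N - (k + 1)\<close> by \<open>N\<close>.\<close>

lemma a_int_recurrence_normalized:
  assumes "Suc (Suc k) \<le> N"
  shows "a_int (Suc (Suc k)) N = real N / (real N - real (Suc k))
    * (real (Suc k) * (2 / (real N)\<^sup>2 * a_int (Suc k) N + 1 / real N ^ 3 * a_int k N))"
proof -
  have "real N - real (Suc k) > 0" "real N > 0" using assms by auto
  with a_int_recurrence[OF assms] show ?thesis
    by (simp add: field_simps eval_nat_numeral del: of_nat_Suc)
qed

text \<open>Passing from \<open>a_int\<close> to \<open>a_tilde\<close> decreases every step of the recursion: it discards the
  prefactor, which is at least \<open>1\<close>, and at even indices a nonnegative summand.\<close>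

lemma a_tilde_le_a_int:
  "N \<ge> 1 \<Longrightarrow> k \<le> N \<Longrightarrow> a_tilde k N \<le> a_int k N"
proof (induction k rule: less_induct)
  case (less k)
  consider "k = 0" | "k = 1" | j where "k = Suc (Suc j)"
    by (metis One_nat_def not0_implies_Suc)
  then show ?case
  proof cases
    case 1
    then show ?thesis using a_tilde_even[of 0 N] by (simp add: odd_double_fact_def)
  next
    case 2
    then show ?thesis using a_tilde_odd[of 0 N] less.prems by simp
  next
    case 3
    define X where
      "X = real (Suc j) * (2 / (real N)\<^sup>2 * a_int (Suc j) N + 1 / real N ^ 3 * a_int j N)"
    have "a_tilde k N \<le> a_tilde_step j N"
      using a_tilde_step_bounds(1) less.prems 3 by simp
    also have "\<dots> \<le> X"
      unfolding a_tilde_step_def X_def using less 3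
      by (intro mult_left_mono add_mono) auto
    also have "\<dots> \<le> real N / (real N - real (Suc j)) * X"
    proof -
      have "X \<ge> 0" unfolding X_def
        using a_int_nonneg[of N j] a_int_nonneg[of N "Suc j"] less.prems 3
        by (intro mult_nonneg_nonneg add_nonneg_nonneg) auto
      moreover have "real N / (real N - real (Suc j)) \<ge> 1"
        using less.prems 3 by (simp add: divide_simps)
      ultimately show ?thesis using mult_right_mono by fastforce
    qed
    also have "\<dots> = a_int k N"
      using a_int_recurrence_normalized[of j N] less.prems 3 by (simp add: X_def)
    finally show ?thesis .
  qed
qed

text \<open>The relative error of one step of the recursion: the prefactor of the normalized recurrence
  (with \<open>p = k + 1\<close>) times the error at an even index (with \<open>q = k\<close>). After clearing
  denominators the claim is \<open>4 q p / 3 + p + 4 p K\<^sup>2 / n \<le> 4 K\<^sup>2\<close>, where the three summands are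
  at most \<open>4 K\<^sup>2 / 3\<close>, \<open>K\<^sup>2\<close> and \<open>1\<close>.\<close>

lemma step_factor_bound:
  fixes n p q K :: real
  assumes "0 \<le> q" "q \<le> p" "p \<le> K" "1 \<le> K" "n > 8 * K ^ 3"
  shows "n / (n - p) * (1 + 4 * q * p / (3 * n)) \<le> 1 + 4 * K\<^sup>2 / n"
proof -
  have K: "K \<le> K\<^sup>2" "K\<^sup>2 \<le> K ^ 3" using assms by (simp_all add: power_increasing self_le_power)
  then have n: "n > 0" "n - p > 0" using assms by linarith+
  have "q * p \<le> K\<^sup>2" unfolding power2_eq_square using assms by (intro mult_mono) auto
  moreover have "4 * p * K\<^sup>2 / n \<le> 1"
  proof -
    have "p * K\<^sup>2 \<le> K * K\<^sup>2" using assms by (intro mult_right_mono) auto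
    also have "\<dots> = K ^ 3" by (simp add: eval_nat_numeral)
    finally show ?thesis using assms n K by (simp add: divide_simps)
  qed
  ultimately have "4 * q * p / 3 + p + 4 * p * K\<^sup>2 / n \<le> 4 * K\<^sup>2"
    using assms K by linarith
  then have "n + 4 * q * p / 3 \<le> (n - p) * (1 + 4 * K\<^sup>2 / n)"
    using n by (simp add: algebra_simps diff_divide_distrib)
  moreover have "n * (1 + 4 * q * p / (3 * n)) = n + 4 * q * p / 3"
    using n by (simp add: distrib_left)
  ultimately have "n * (1 + 4 * q * p / (3 * n)) \<le> (1 + 4 * K\<^sup>2 / n) * (n - p)"
    by (simp only: mult.commute)
  then show ?thesis using n by (simp only: times_divide_eq_left pos_divide_le_eq)
qed

text \<open>The bound \<open>K\<close> on the indices is kept apart from the induction variable so that the error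
  factor per step is the same throughout the induction.\<close>

lemma a_int_le_a_tilde:
  fixes K N :: nat
  assumes "1 \<le> K" "K \<le> N" "real N > 8 * real K ^ 3"
  shows "k \<le> K \<Longrightarrow> a_int k N \<le> (1 + 4 * (real K)\<^sup>2 / real N) ^ k * a_tilde k N"
proof (induction k rule: less_induct)
  case (less k)
  define q where "q = 1 + 4 * (real K)\<^sup>2 / real N"
  have q: "q \<ge> 1" by (simp add: q_def)
  consider "k = 0" | "k = 1" | j where "k = Suc (Suc j)"
    by (metis One_nat_def not0_implies_Suc)
  then show ?case
  proof cases
    case 1
    then show ?thesis using a_tilde_even[of 0 N] by (simp add: odd_double_fact_def)
  next
    case 2
    then show ?thesis using a_tilde_odd[of 0 N] assms by simp
  next
    case 3
    let ?r = "real N / (real N - real (Suc j))"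
    have r: "?r \<ge> 0" using less.prems 3 assms by simp
    have "a_int j N \<le> q ^ j * a_tilde j N"
      using less.IH[of j] less.prems 3 by (simp add: q_def)
    also have "\<dots> \<le> q ^ Suc j * a_tilde j N"
      using q by (intro mult_right_mono a_tilde_nonneg power_increasing) auto
    \<comment> \<open>Both hypotheses are brought to the common factor \<open>q ^ (j + 1)\<close>.\<close>
    finally have IH0: "a_int j N \<le> q ^ Suc j * a_tilde j N" .
    have IH1: "a_int (Suc j) N \<le> q ^ Suc j * a_tilde (Suc j) N"
      using less.IH[of "Suc j"] less.prems 3 by (simp add: q_def)
    have "a_int k N
        = ?r * (real (Suc j) * (2 / (real N)\<^sup>2 * a_int (Suc j) N + 1 / real N ^ 3 * a_int j N))"
      using a_int_recurrence_normalized[of j N] less.prems 3 assms by simp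
    also have "\<dots> \<le> ?r * (real (Suc j) * (2 / (real N)\<^sup>2 * (q ^ Suc j * a_tilde (Suc j) N)
        + 1 / real N ^ 3 * (q ^ Suc j * a_tilde j N)))"
      by (intro mult_left_mono[OF _ r] mult_left_mono add_mono IH0 IH1) auto
    also have "\<dots> = q ^ Suc j * (?r * a_tilde_step j N)"
      by (simp only: a_tilde_step_def distrib_left mult_ac)
    also have "\<dots> \<le> q ^ Suc j
        * (?r * ((1 + 4 * real j * real (Suc j) / (3 * real N)) * a_tilde k N))"
      using a_tilde_step_bounds(2)[of N j] 3 assms q
      by (intro mult_left_mono[OF mult_left_mono[OF _ r]]) simp_all
    also have "\<dots> = q ^ Suc j
        * ((?r * (1 + 4 * real j * real (Suc j) / (3 * real N))) * a_tilde k N)"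
      by (simp only: mult.assoc)
    also have "\<dots> \<le> q ^ Suc j * (q * a_tilde k N)"
      unfolding q_def using less.prems 3 assms q
      by (intro mult_left_mono mult_right_mono a_tilde_nonneg step_factor_bound) auto
    also have "\<dots> = q ^ k * a_tilde k N" by (simp add: 3)
    finally show ?thesis by (simp add: q_def)
  qed
qed

text \<open>Bernoulli's inequality reversed, at the cost of a factor \<open>2\<close>, which holds as long as
  \<open>k c\<close> stays bounded by \<open>1\<close>; it follows from \<open>1 + c \<le> exp c\<close> and
  \<open>exp x \<le> 1 + x + x\<^sup>2\<close> on the unit interval.\<close>

lemma one_plus_power_le:
  fixes c :: real
  assumes "0 \<le> c" "real k * c \<le> 1"
  shows "(1 + c) ^ k \<le> 1 + 2 * (real k * c)"
proof -
  have "(1 + c) ^ k \<le> exp c ^ k"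
    using assms by (intro power_mono) (auto simp: exp_ge_add_one_self)
  also have "\<dots> = exp (real k * c)" by (simp add: exp_of_nat_mult)
  also have "\<dots> \<le> 1 + real k * c + (real k * c)\<^sup>2"
    using assms by (intro exp_bound) auto
  finally have "(1 + c) ^ k \<le> 1 + real k * c + (real k * c)\<^sup>2" .
  moreover have "(real k * c)\<^sup>2 \<le> real k * c"
    unfolding power2_eq_square using assms by (intro mult_left_le) auto
  ultimately show ?thesis by linarith
qed

lemma a_int_asymptotics:
  assumes "1 \<le> k" "k \<le> N" "real N > 8 * real k ^ 3"
  shows "\<bar>a_int k N - a_tilde k N\<bar> \<le> 8 * (real k ^ 3 / real N) * a_tilde k N"
proof -
  let ?c = "4 * (real k)\<^sup>2 / real N"
  have kc: "real k * ?c = 4 * (real k ^ 3 / real N)"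
    by (simp add: eval_nat_numeral)
  have "real k * ?c \<le> 1" unfolding kc using assms by (simp add: divide_simps)
  then have "(1 + ?c) ^ k \<le> 1 + 2 * (real k * ?c)" by (intro one_plus_power_le) simp_all
  then have "(1 + ?c) ^ k * a_tilde k N \<le> (1 + 8 * (real k ^ 3 / real N)) * a_tilde k N"
    unfolding kc by (intro mult_right_mono a_tilde_nonneg) simp
  with a_int_le_a_tilde[OF assms order_refl]
  have "a_int k N \<le> (1 + 8 * (real k ^ 3 / real N)) * a_tilde k N" by linarith
  moreover have "a_tilde k N \<le> a_int k N" using a_tilde_le_a_int assms by simp
  ultimately show ?thesis by (simp add: algebra_simps)
qed

lemma a_int_formula:
  assumes "k \<le> N"
  shows "a_int k N = (\<Sum>l=0..k. real (k choose l) * (1 / falling_fact (real N) l)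
    * (- real N) powi (- (int k - int l)))"
  unfolding a_int_eq_binomial_transform[OF assms] binomial_transform_def atMost_atLeast0
proof (intro sum.cong refl)
  fix l assume "l \<in> {0..k}"
  then have "- (int k - int l) = - int (k - l)" by auto
  moreover have "- (1 / real N) = inverse (- real N)" by (simp add: inverse_eq_divide)
  ultimately have "(- real N) powi (- (int k - int l)) = (- (1 / real N)) ^ (k - l)"
    by (simp only: power_int_minus power_int_of_nat power_inverse)
  then show "real (k choose l) * (1 / falling_fact (real N) l) * (- (1 / real N)) ^ (k - l)
      = real (k choose l) * (1 / falling_fact (real N) l) * (- real N) powi (- (int k - int l))"
    by (simp only:)
qed

theorem proposition3p3:
  "(\<forall>N k :: nat. N \<ge> 1 \<and> k \<le> N \<longrightarrow>
      a_int k N = (\<Sum>l=0..k. real (k choose l) * (1 / falling_fact (real N) l)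
                 * (- real N) powi (- (int k - int l))))
   \<and> (\<forall>N k :: nat. N \<ge> 1 \<and> k \<le> N \<and> k \<ge> 2 \<longrightarrow> a_int k N > 0)
   \<and> (\<forall>N :: nat. N \<ge> 1 \<longrightarrow> a_int 0 N = 1 \<and> a_int 1 N = 0)
   \<and> (\<exists>C\<^sub>1 C\<^sub>2 :: real. C\<^sub>1 > 0 \<and> C\<^sub>2 > 0 \<and>
        (\<forall>N k :: nat. k \<ge> 1 \<and> k \<le> N \<and> real N > C\<^sub>1 * real k ^ 3 \<longrightarrow>
           \<bar>a_int k N - a_tilde k N\<bar> \<le> C\<^sub>2 * (real k ^ 3 / real N) * a_tilde k N))"
proof (intro conjI allI impI)
  fix N k :: nat
  assume "N \<ge> 1 \<and> k \<le> N"
  then show "a_int k N = (\<Sum>l=0..k. real (k choose l) * (1 / falling_fact (real N) l)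
      * (- real N) powi (- (int k - int l)))"
    by (intro a_int_formula) simp
next
  fix N k :: nat
  assume "N \<ge> 1 \<and> k \<le> N \<and> k \<ge> 2"
  then show "a_int k N > 0" by (simp add: a_int_pos)
next
  fix N :: nat
  assume "N \<ge> 1"
  then show "a_int 0 N = 1" and "a_int 1 N = 0" by simp_all
next
  have "\<forall>N k :: nat. k \<ge> 1 \<and> k \<le> N \<and> real N > 8 * real k ^ 3 \<longrightarrow>
      \<bar>a_int k N - a_tilde k N\<bar> \<le> 8 * (real k ^ 3 / real N) * a_tilde k N"
    using a_int_asymptotics by blast
  then show "\<exists>C\<^sub>1 C\<^sub>2 :: real. C\<^sub>1 > 0 \<and> C\<^sub>2 > 0 \<and>
        (\<forall>N k :: nat. k \<ge> 1 \<and> k \<le> N \<and> real N > C\<^sub>1 * real k ^ 3 \<longrightarrow>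
           \<bar>a_int k N - a_tilde k N\<bar> \<le> C\<^sub>2 * (real k ^ 3 / real N) * a_tilde k N)"
    by (intro exI[of _ "8 :: real"] conjI) simp_all
qed

end
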